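(* Let $\xi:[1,n]\to\mathbb Z$ be a height function. For $1\le i<j\le n$ the following identities hold in $\mathcal A(\mathbf x,Q_\xi)$: $$x_i\,x[\alpha_i]=f_i\,x_{i+1}^{1-d_i}+f_{i+1}^{1-d_i}\,x_{i-1}\,x_{i+1}^{d_i},$$ $$x_j\,x[\alpha_{i,j}]=f_j^{d_{j-1}}\,x[\alpha_{i,j-1}]\,x_{j+1}^{1-d_j}+f_{j+1}^{1-d_j}x_{j+1}^{d_j}\Big((\delta_{i_\bullet,j_\bullet}+\delta_{i,j_\bullet})f_i^{\delta_{i,j_\bullet}}x_{i-1}^{1-\delta_{i,j_\bullet}}+(1-\delta_{i_\bullet,j_\bullet}-\delta_{i,j_\bullet})f_{j_\bullet}^{d_{j_\bullet-1}}x[\alpha_{i,j_\bullet-1}]\Big).$$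
   Context: Combinatorics. Let $n\ge2$ and $[i,j]=\{i,i+1,\dots,j\}$. A height function is a map $\xi:[1,n]\to\mathbb Z$ with $|\xi(i)-\xi(i-1)|=1$ for $2\le i\le n$; it is extended to $[0,n+1]$ by $\xi(0)=\xi(2)$, $\xi(n+1)=\xi(n-1)$. For $i\in[1,n-2]$ let $i_\diamond\in[i,n]$ be minimal such that $\xi(i_\diamond)=\xi(i_\diamond+2)$; set $(n-1)_\diamond=n-1$ and $n_\diamond=n$. Let $d_j=\delta_{j,j_\diamond}$ for $1\le j\le n$ (Kronecker delta). Quiver. $Q_\xi$ is the quiver with vertices $1,\dots,n,1',\dots,n'$, where $1',\dots,n'$ are frozen, with no edges between primed vertices. For $1\le j\le n-1$ with $\xi(j)=\xi(j+1)+1$ the edges at $j$ are: $j\to j-1$ (if $j\ge2$); $j'\to j$; if $j=j_\diamond$, $j\to j+1$; if $j\ne j_\diamond$, $j+1\to j$ and $j\to(j+1)'$. If $\xi(j)=\xi(j+1)-1$ all these edges have reversed orientation. At $n$ the edges are $(n-1)\to n\to n'$ if $\xi(n-1)=\xi(n)+1$ and reversed otherwise. Ignoring the frozen vertices, $j$ is a sink or source of $Q_\xi$ iff $j=1$ or $j=j_\diamond$. Set $2_\bullet=1$, and for $2<j\le n$ let $j_\bullet$ be the maximal sink or source of $Q_\xi$ (in this sense, so vertex $1$ always counts) satisfying $j_\bullet<j$. The symbol $1_\bullet$, which occurs only in $\delta_{1_\bullet,j_\bullet}$ with $j\ge2$, is read as $0$. Cluster algebra. $\mathcal A(\mathbf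 x,Q_\xi)$ is the cluster algebra with initial seed $(\mathbf x,Q_\xi)$, $\mathbf x=\{x_1,\dots,x_n,f_1,\dots,f_n\}$ algebraically independent, $f_i$ the frozen variable at $i'$. Let $\alpha_1,\dots,\alpha_n$ be simple roots of type $A_n$ and $\alpha_{i,j}=\alpha_i+\dots+\alpha_j$. The non-frozen cluster variables are indexed by the almost positive roots: $x[-\alpha_i]=x_i$, and $x[\alpha_{i,j}]$ ($1\le i\le j\le n$) is the cluster variable with denominator $x_ix_{i+1}\cdots x_j$ with respect to $x_1,\dots,x_n$ (it is obtained from the initial seed by mutating successively at $i,i+1,\dots,j$). Conventions: $x_0=x_{n+1}=1$; $\alpha_{i,m}=\alpha_m$ for $m\le i$; a term whose numerical coefficient is $0$ is omitted, and a symbol raised to the exponent $0$ equals $1$ (even if its index is out of range).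
   Formalization: The second identity as printed fails when i=j_•=1 and d_1=0 (e.g. n=3, ξ=(2,1,0), i=1, j=2); the exponent of f_i is corrected from δ_{i,j_•} to δ_{i,j_•}·d_i, which changes the formula only in those cases. *)

theory Defs
  imports Complex_Main "HOL-Library.Poly_Mapping"
begin

section \<open>Height functions\<close>

definition height_function :: "nat \<Rightarrow> (nat \<Rightarrow> int) \<Rightarrow> bool" where
  "height_function n \<xi> \<longleftrightarrow> (\<forall>i\<in>{2..n}. \<bar>\<xi> i - \<xi> (i - 1)\<bar> = 1)"

text \<open>Extension to \<open>[0,n+1]\<close>; only the values on \<open>[1,n]\<close> of the given map are used.\<close>

definition ext_height :: "nat \<Rightarrow> (nat \<Rightarrow> int) \<Rightarrow> nat \<Rightarrow> int" where
  "ext_height n \<xi> i = (if i = 0 then \<xi> 2 else if i = n + 1 then \<xi> (n - 1) else \<xi> i)"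

text \<open>For \<open>i \<le> n - 2\<close> the minimum exists and is at most \<open>n - 1\<close>, because the extended height
  function takes the same value at \<open>n - 1\<close> and \<open>n + 1\<close>.  In particular the value at \<open>n + 2\<close>
  plays no role.\<close>

definition diamond :: "nat \<Rightarrow> (nat \<Rightarrow> int) \<Rightarrow> nat \<Rightarrow> nat" where
  "diamond n \<xi> i =
     (if i + 2 \<le> n
      then (LEAST m. i \<le> m \<and> m \<le> n \<and> ext_height n \<xi> m = ext_height n \<xi> (m + 2))
      else i)"

definition dlt :: "nat \<Rightarrow> (nat \<Rightarrow> int) \<Rightarrow> nat \<Rightarrow> nat" where
  "dlt n \<xi> j = of_bool (j = diamond n \<xi> j)"

section \<open>The quiver\<close>

text \<open>\<open>Mut i\<close> is the mutable vertex \<open>i\<close>, and \<open>Fro i\<close> is the frozen vertex \<open>i'\<close>.\<close>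

datatype vertex = Mut nat | Fro nat

definition vertices :: "nat \<Rightarrow> vertex set" where
  "vertices n = Mut ` {1..n} \<union> Fro ` {1..n}"

text \<open>The edges at \<open>j\<close> in the descending case; a pair \<open>(u, v)\<close> is an arrow from \<open>u\<close> to \<open>v\<close>.\<close>

definition edges_at :: "nat \<Rightarrow> (nat \<Rightarrow> int) \<Rightarrow> nat \<Rightarrow> (vertex \<times> vertex) set" where
  "edges_at n \<xi> j =
     (if j < n
      then (if 2 \<le> j then {(Mut j, Mut (j - 1))} else {})
           \<union> {(Fro j, Mut j)}
           \<union> (if j = diamond n \<xi> j
              then {(Mut j, Mut (j + 1))}
              else {(Mut (j + 1), Mut j), (Mut j, Fro (j + 1))})
      else {(Mut (n - 1), Mut n), (Mut n, Fro n)})"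

definition descends_at :: "nat \<Rightarrow> (nat \<Rightarrow> int) \<Rightarrow> nat \<Rightarrow> bool" where
  "descends_at n \<xi> j \<longleftrightarrow> (if j < n then \<xi> j = \<xi> (j + 1) + 1 else \<xi> (n - 1) = \<xi> n + 1)"

text \<open>An edge between two mutable vertices is described at both of its ends, hence a union of sets.\<close>

definition quiver :: "nat \<Rightarrow> (nat \<Rightarrow> int) \<Rightarrow> (vertex \<times> vertex) set" where
  "quiver n \<xi> =
     (\<Union>j\<in>{1..n}. if descends_at n \<xi> j then edges_at n \<xi> j else (edges_at n \<xi> j)\<inverse>)"

definition sink_or_source :: "nat \<Rightarrow> (nat \<Rightarrow> int) \<Rightarrow> nat \<Rightarrow> bool" where
  "sink_or_source n \<xi> j \<longleftrightarrow>
     (\<forall>k\<in>{1..n}. (Mut j, Mut k) \<notin> quiver n \<xi>) \<or> (\<forall>k\<in>{1..n}. (Mut k, Mut j) \<notin> quiver n \<xi>)"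

definition bullet :: "nat \<Rightarrow> (nat \<Rightarrow> int) \<Rightarrow> nat \<Rightarrow> nat" where
  "bullet n \<xi> j =
     (if j \<le> 1 then 0
      else if j = 2 then 1
      else Max {k. 1 \<le> k \<and> k < j \<and> sink_or_source n \<xi> k})"

section \<open>Seeds, mutation and cluster variables\<close>

text \<open>A quiver without loops and oriented 2-cycles is encoded by its signed adjacency matrix: the
  entry at \<open>(u, v)\<close> is the number of arrows from \<open>u\<close> to \<open>v\<close> minus the number of arrows from
  \<open>v\<close> to \<open>u\<close>.\<close>

type_synonym exch_matrix = "vertex \<Rightarrow> vertex \<Rightarrow> int"

definition matrix_of :: "(vertex \<times> vertex) set \<Rightarrow> exch_matrix" where
  "matrix_of Q u v = of_bool ((u, v) \<in> Q) - of_bool ((v, u) \<in> Q)"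

type_synonym 'a seed = "(vertex \<Rightarrow> 'a) \<times> exch_matrix"

text \<open>Arrows between frozen vertices that mutation would create are discarded.\<close>

fun mutate_matrix :: "vertex \<Rightarrow> exch_matrix \<Rightarrow> exch_matrix" where
  "mutate_matrix w b u v =
     (if u = w \<or> v = w then - b u v
      else if u \<in> range Fro \<and> v \<in> range Fro then 0
      else b u v + max (b u w) 0 * max (b w v) 0 - max (- b u w) 0 * max (- b w v) 0)"

definition mutate :: "nat \<Rightarrow> vertex \<Rightarrow> ('a::field) seed \<Rightarrow> 'a seed" where
  "mutate n w s =
     (case s of (y, b) \<Rightarrow>
        (y(w := ((\<Prod>v\<in>vertices n. y v ^ nat (b v w)) + (\<Prod>v\<in>vertices n. y v ^ nat (b w v))) / y w),
         mutate_matrix w b))"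

fun initial_cluster :: "(nat \<Rightarrow> 'a) \<Rightarrow> (nat \<Rightarrow> 'a) \<Rightarrow> vertex \<Rightarrow> 'a" where
  "initial_cluster x f (Mut i) = x i"
| "initial_cluster x f (Fro i) = f i"

definition initial_seed ::
  "nat \<Rightarrow> (nat \<Rightarrow> int) \<Rightarrow> (nat \<Rightarrow> 'a) \<Rightarrow> (nat \<Rightarrow> 'a) \<Rightarrow> 'a seed" where
  "initial_seed n \<xi> x f = (initial_cluster x f, matrix_of (quiver n \<xi>))"

inductive reachable :: "nat \<Rightarrow> ('a::field) seed \<Rightarrow> 'a seed \<Rightarrow> bool" for n s where
  base: "reachable n s s"
| step: "reachable n s t \<Longrightarrow> k \<in> {1..n} \<Longrightarrow> reachable n s (mutate n (Mut k) t)"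

definition cluster_variable :: "nat \<Rightarrow> ('a::field) seed \<Rightarrow> 'a \<Rightarrow> bool" where
  "cluster_variable n s z \<longleftrightarrow> (\<exists>t k. reachable n s t \<and> k \<in> {1..n} \<and> z = fst t (Mut k))"

section \<open>Algebraic independence and denominators\<close>

text \<open>Polynomials in variables indexed by vertices are finitely supported maps from monomials to
  coefficients; the coefficients are sent to the target field by \<open>\<phi>\<close>.\<close>

definition poly_eval ::
  "('c::zero \<Rightarrow> 'a) \<Rightarrow> (vertex \<Rightarrow> 'a) \<Rightarrow> ((vertex \<Rightarrow>\<^sub>0 nat) \<Rightarrow>\<^sub>0 'c) \<Rightarrow> 'a::field" where
  "poly_eval \<phi> y p =
     (\<Sum>m\<in>Poly_Mapping.keys p. \<phi> (Poly_Mapping.lookup p m) *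
        (\<Prod>v\<in>Poly_Mapping.keys m. y v ^ Poly_Mapping.lookup m v))"

definition poly_in :: "vertex set \<Rightarrow> ((vertex \<Rightarrow>\<^sub>0 nat) \<Rightarrow>\<^sub>0 'c::zero) \<Rightarrow> bool" where
  "poly_in V p \<longleftrightarrow> (\<forall>m\<in>Poly_Mapping.keys p. Poly_Mapping.keys m \<subseteq> V)"

definition algebraically_independent :: "vertex set \<Rightarrow> (vertex \<Rightarrow> 'a::field_char_0) \<Rightarrow> bool" where
  "algebraically_independent V y \<longleftrightarrow>
     (\<forall>p :: (vertex \<Rightarrow>\<^sub>0 nat) \<Rightarrow>\<^sub>0 rat. poly_in V p \<longrightarrow> poly_eval of_rat y p = 0 \<longrightarrow> p = 0)"

definition poly_var :: "vertex \<Rightarrow> ((vertex \<Rightarrow>\<^sub>0 nat) \<Rightarrow>\<^sub>0 int)" where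
  "poly_var v = Poly_Mapping.single (Poly_Mapping.single v 1) 1"

text \<open>The element \<open>z\<close> has denominator \<open>\<Prod>k. x k ^ a k\<close> with respect to the initial cluster:
  \<open>z = N / (\<Prod>k. x k ^ a k)\<close>, where \<open>N\<close> is a polynomial in the \<open>x k\<close> divisible by none of them, whose
  coefficients are integral Laurent polynomials in the frozen variables.  The monomial with exponents
  \<open>e\<close> clears the frozen variables from the denominators of these coefficients; it does not
  affect divisibility by the \<open>x k\<close>.\<close>

definition has_denominator ::
  "nat \<Rightarrow> (nat \<Rightarrow> 'a) \<Rightarrow> (nat \<Rightarrow> 'a) \<Rightarrow> (nat \<Rightarrow> nat) \<Rightarrow> 'a::field_char_0 \<Rightarrow> bool" where
  "has_denominator n x f a z \<longleftrightarrow>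
     (\<exists>p (e :: nat \<Rightarrow> nat).
        poly_in (vertices n) p
        \<and> z * (\<Prod>k=1..n. x k ^ a k) * (\<Prod>k=1..n. f k ^ e k) = poly_eval of_int (initial_cluster x f) p
        \<and> (\<forall>k\<in>{1..n}. \<not> poly_var (Mut k) dvd p))"

text \<open>Coefficients of the root \<open>\<alpha>\<^bsub>i,j\<^esub> = \<alpha>\<^bsub>i\<^esub> + \<dots> + \<alpha>\<^bsub>j\<^esub>\<close>, with the convention
  \<open>\<alpha>\<^bsub>i,m\<^esub> = \<alpha>\<^bsub>m\<^esub>\<close> for \<open>m \<le> i\<close>.\<close>

definition root_coeff :: "nat \<Rightarrow> nat \<Rightarrow> nat \<Rightarrow> nat" where
  "root_coeff i j k = of_bool (min i j \<le> k \<and> k \<le> j)"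

text \<open>The cluster variable \<open>x[\<alpha>\<^bsub>i,j\<^esub>]\<close>, obtained from the initial seed by mutating at
  \<open>i, i + 1, \<dots>, j\<close> (only at \<open>j\<close> if \<open>j \<le> i\<close>).\<close>

definition root_variable ::
  "nat \<Rightarrow> (nat \<Rightarrow> int) \<Rightarrow> (nat \<Rightarrow> 'a) \<Rightarrow> (nat \<Rightarrow> 'a) \<Rightarrow> nat \<Rightarrow> nat \<Rightarrow> 'a::field" where
  "root_variable n \<xi> x f i j =
     fst (fold (\<lambda>k. mutate n (Mut k)) [min i j..<Suc j] (initial_seed n \<xi> x f)) (Mut j)"

end

theory Submission
  imports Defs
begin

text \<open>
  Let \<open>slope j = \<xi>(j) - \<xi>(j+1) = \<plusminus>1\<close> for the extended height function.  Column \<open>j\<close> of the exchange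
  matrix is \<open>slope j\<close> times the difference of two indicator functions, and \<open>d j = 1\<close> exactly when the
  slope changes sign between \<open>j\<close> and \<open>j + 1\<close>.  Mutating at \<open>i, i+1, \<dots>, j\<close> changes, among the columns not
  yet mutated, only the column \<open>j + 1\<close>: it receives the entries of column \<open>j\<close> of one sign, namely the
  positive part \<open>X i (j-1) * f j ^ d (j-1)\<close> (or \<open>f i\<close> for \<open>j = i\<close>) if the slope changes sign at \<open>j\<close>, and the negative part that column \<open>j\<close>
  itself inherited otherwise.  So the inherited negative part is the one created at the last sign
  change before the current vertex, which is the vertex \<open>bullet\<close>, or else it is the left neighbour \<open>i - 1\<close>.

  For the denominators, the exchange relations multiplied by \<open>x i \<cdots> x (j-1)\<close> give a recursion for the
  numerators without subtraction.  A numerator is not divisible by \<open>x k\<close>, because it stays positive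
  when \<open>x k = 0\<close> and all other variables are \<open>1\<close>: no variable can occur in both summands of the recursion.
\<close>

section \<open>Slopes and the quiver\<close>

locale height_quiver =
  fixes n :: nat and \<xi> :: "nat \<Rightarrow> int"
  assumes n_ge_2: "2 \<le> n" and height: "height_function n \<xi>"
begin

section \<open>Slopes of the extended height function and the vertices where they change
  sign\<close>

definition slope :: "nat \<Rightarrow> int" where
  "slope j = ext_height n \<xi> j - ext_height n \<xi> (Suc j)"

definition turn :: "nat \<Rightarrow> bool" where
  "turn j \<longleftrightarrow> j = diamond n \<xi> j"

lemma slope_cases:
  assumes "1 \<le> j" "j \<le> n"
  shows "slope j = 1 \<or> slope j = -1"
proof -
  have *: "\<bar>\<xi> i - \<xi> (i - 1)\<bar> = 1" if "2 \<le> i" "i \<le> n" for i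
    using height that by (auto simp: height_function_def)
  have "\<bar>slope j\<bar> = 1"
    using *[of "Suc j"] *[of n] assms n_ge_2 by (cases "j = n") (auto simp: slope_def ext_height_def)
  then show ?thesis by linarith
qed

lemma turn_n: "turn n"
  by (simp add: turn_def diamond_def)

text \<open>The slopes at \<open>j\<close> and \<open>j + 1\<close> sum to the difference of the
  heights at \<open>j\<close> and \<open>j + 2\<close>, so they cancel exactly when the minimum in
  \<open>diamond\<close> is attained at \<open>j\<close>. For \<open>j = n - 1\<close> the reflected
  value at \<open>n + 1\<close> forces opposite slopes.\<close>

lemma turn_iff:
  assumes "1 \<le> j" "j < n"
  shows "turn j \<longleftrightarrow> slope (Suc j) = - slope j"
proof (cases "j + 2 \<le> n")
  case True
  let ?P = "\<lambda>m. j \<le> m \<and> m \<le> n \<and> ext_height n \<xi> m = ext_height n \<xi> (m + 2)"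
  have "?P (n - 1)" using True by (auto simp: ext_height_def)
  then have "?P (LEAST m. ?P m)" by (rule LeastI)
  moreover have "(LEAST m. ?P m) = j" if "?P j"
    using that by (intro Least_equality) auto
  ultimately have "(LEAST m. ?P m) = j \<longleftrightarrow> ext_height n \<xi> j = ext_height n \<xi> (j + 2)"
    using assms by auto
  then show ?thesis using True
    by (auto simp: turn_def diamond_def slope_def)
next
  case False
  then have "Suc j = n" using assms by simp
  moreover have "slope n = - slope (n - 1)"
    using n_ge_2 by (auto simp: slope_def ext_height_def)
  ultimately show ?thesis using False by (auto simp: turn_def diamond_def)
qed

text \<open>By reflection the slope at \<open>n\<close> is the height at \<open>n\<close> minus the
  one at \<open>n - 1\<close>, so the test at the last vertex has the opposite sign.\<close>

lemma descends_iff: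
  assumes "1 \<le> j" "j \<le> n"
  shows "descends_at n \<xi> j \<longleftrightarrow> slope j = (if j < n then 1 else -1)"
proof (cases "j < n")
  case True
  then have "slope j = \<xi> j - \<xi> (Suc j)" using assms by (simp add: slope_def ext_height_def)
  then have "slope j = 1 \<longleftrightarrow> \<xi> j = \<xi> (j + 1) + 1" by simp linarith
  then show ?thesis using True by (simp only: descends_at_def if_True)
next
  case False
  then have "slope j = \<xi> n - \<xi> (n - 1)" using assms n_ge_2 by (simp add: slope_def ext_height_def)
  then have "slope j = -1 \<longleftrightarrow> \<xi> (n - 1) = \<xi> n + 1" by linarith
  then show ?thesis using False by (simp only: descends_at_def if_False)
qed

section \<open>Arrows, sinks and sources in terms of slopes\<close>

lemma quiver_iff:
  "(u, v) \<in> quiver n \<xi> \<longleftrightarrow>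
    (\<exists>j\<in>{1..n}. (if slope j = (if j < n then 1 else -1) then (u, v) else (v, u)) \<in> edges_at n \<xi> j)"
proof -
  have "(u, v) \<in> (if descends_at n \<xi> j then edges_at n \<xi> j else (edges_at n \<xi> j)\<inverse>) \<longleftrightarrow>
    (if slope j = (if j < n then 1 else -1) then (u, v) else (v, u)) \<in> edges_at n \<xi> j"
    if "j \<in> {1..n}" for j
    using descends_iff[of j] that by simp
  then show ?thesis unfolding quiver_def by blast
qed

lemma slope_turn:
  assumes "1 \<le> j" "j < n"
  shows "slope (Suc j) = (if turn j then - slope j else slope j)"
proof -
  have "slope j = 1 \<or> slope j = -1" "slope (Suc j) = 1 \<or> slope (Suc j) = -1"
    using slope_cases[of j] slope_cases[of "Suc j"] assms by simp_all
  then show ?thesis unfolding turn_iff[OF assms] by (elim disjE) simp_all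
qed

text \<open>An edge between neighbours is oriented by the slope of its right end. The description at
  its left end agrees, because there \<open>edges_at\<close> reverses the edge precisely when the
  slope changes sign.\<close>

lemma Mut_Mut_quiver:
  "(Mut a, Mut b) \<in> quiver n \<xi> \<longleftrightarrow>
     1 \<le> a \<and> a \<le> n \<and> 1 \<le> b \<and> b \<le> n \<and>
     (b = Suc a \<and> slope b = -1 \<or> a = Suc b \<and> slope a = 1)"
  (is "_ \<longleftrightarrow> ?R")
proof
  assume "(Mut a, Mut b) \<in> quiver n \<xi>"
  then obtain j where j: "1 \<le> j" "j \<le> n"
    and arrow: "(if slope j = (if j < n then 1 else -1) then (Mut a, Mut b) else (Mut b, Mut a)) \<in> edges_at n \<xi> j"
    by (auto simp: quiver_iff)
  have slope: "slope j = 1 \<or> slope j = -1" using j by (rule slope_cases)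
  show ?R
  proof (cases "j = n")
    case True
    then show ?thesis using slope arrow n_ge_2 by (elim disjE) (auto simp: edges_at_def)
  next
    case False
    then have less: "j < n" using j by simp
    have *: "(u, v) \<in> edges_at n \<xi> j \<Longrightarrow> u = Mut c \<Longrightarrow> v = Mut d \<Longrightarrow>
      c = j \<and> j = Suc d \<and> 1 \<le> d \<or> turn j \<and> c = j \<and> d = Suc j \<or> \<not> turn j \<and> c = Suc j \<and> d = j" for u v c d
      using less by (auto simp: edges_at_def turn_def[symmetric] split: if_splits)
    from slope show ?thesis
    proof
      assume "slope j = 1"
      then show ?thesis using *[of "Mut a" "Mut b" a b] arrow less j slope_turn[of j] by auto
    next
      assume "slope j = -1"
      then show ?thesis using *[of "Mut b" "Mut a" b a] arrow less j slope_turn[of j] by auto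
    qed
  qed
next
  assume R: ?R
  \<comment> \<open>At its right end the edge is listed whether or not that vertex is a
    turn.\<close>
  define j where "j = max a b"
  have "(if slope j = (if j < n then 1 else -1) then (Mut a, Mut b) else (Mut b, Mut a)) \<in> edges_at n \<xi> j"
    using R
  proof (elim conjE disjE)
    assume *: "b = Suc a" "slope b = -1" "1 \<le> a" "b \<le> n"
    then have "j = b" "b - 1 = a" by (auto simp: j_def)
    then show ?thesis using * by (auto simp: edges_at_def)
  next
    assume *: "a = Suc b" "slope a = 1" "1 \<le> b" "a \<le> n"
    then have "j = a" "a - 1 = b" by (auto simp: j_def)
    then show ?thesis using * by (auto simp: edges_at_def)
  qed
  moreover have "j \<in> {1..n}" using R by (auto simp: j_def)
  ultimately show "(Mut a, Mut b) \<in> quiver n \<xi>"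
    unfolding quiver_iff by blast
qed

lemma Fro_Mut_quiver:
  "(Fro a, Mut b) \<in> quiver n \<xi> \<longleftrightarrow>
     1 \<le> b \<and> b \<le> n \<and> (a = b \<and> slope b = 1 \<or> a = Suc b \<and> \<not> turn b \<and> slope b = -1)"
proof -
  have "(if slope j = (if j < n then 1 else -1) then (Fro a, Mut b) else (Mut b, Fro a)) \<in> edges_at n \<xi> j
      \<longleftrightarrow> j = b \<and> (a = b \<and> slope b = 1 \<or> a = Suc b \<and> \<not> turn b \<and> slope b = -1)"
    if "j \<in> {1..n}" for j
  proof (cases "j = n")
    case True
    moreover have "slope n = 1 \<or> slope n = -1" using slope_cases[of n] n_ge_2 by simp
    ultimately show ?thesis using turn_n n_ge_2 by (elim disjE) (auto simp: edges_at_def)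
  next
    case False
    then have "j < n" "slope j = 1 \<or> slope j = -1" using that slope_cases[of j] by auto
    then show ?thesis by (elim disjE) (auto simp: edges_at_def turn_def[symmetric])
  qed
  then show ?thesis unfolding quiver_iff by auto
qed

lemma Mut_Fro_quiver:
  "(Mut b, Fro a) \<in> quiver n \<xi> \<longleftrightarrow>
     1 \<le> b \<and> b \<le> n \<and> (a = b \<and> slope b = -1 \<or> a = Suc b \<and> \<not> turn b \<and> slope b = 1)"
proof -
  have "(if slope j = (if j < n then 1 else -1) then (Mut b, Fro a) else (Fro a, Mut b)) \<in> edges_at n \<xi> j
      \<longleftrightarrow> j = b \<and> (a = b \<and> slope b = -1 \<or> a = Suc b \<and> \<not> turn b \<and> slope b = 1)"
    if "j \<in> {1..n}" for j
  proof (cases "j = n")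
    case True
    moreover have "slope n = 1 \<or> slope n = -1" using slope_cases[of n] n_ge_2 by simp
    ultimately show ?thesis using turn_n n_ge_2 by (elim disjE) (auto simp: edges_at_def)
  next
    case False
    then have "j < n" "slope j = 1 \<or> slope j = -1" using that slope_cases[of j] by auto
    then show ?thesis by (elim disjE) (auto simp: edges_at_def turn_def[symmetric])
  qed
  then show ?thesis unfolding quiver_iff by auto
qed

text \<open>The edges to \<open>k - 1\<close> and \<open>k + 1\<close> are oriented by the slopes at
  \<open>k\<close> and \<open>k + 1\<close>; both leave or both enter \<open>k\<close> exactly when
  these slopes are opposite. Vertex 1 has a single neighbour.\<close>

lemma sink_or_source_iff:
  assumes "1 \<le> k" "k < n"
  shows "sink_or_source n \<xi> k \<longleftrightarrow> k = 1 \<or> turn k"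
proof -
  have right: "(\<exists>l\<in>{1..n}. (Mut k, Mut l) \<in> quiver n \<xi>) \<longleftrightarrow> 2 \<le> k \<and> slope k = 1 \<or> slope (Suc k) = -1"
  proof
    assume "\<exists>l\<in>{1..n}. (Mut k, Mut l) \<in> quiver n \<xi>"
    then show "2 \<le> k \<and> slope k = 1 \<or> slope (Suc k) = -1"
      by (auto simp: Mut_Mut_quiver)
  next
    assume "2 \<le> k \<and> slope k = 1 \<or> slope (Suc k) = -1"
    then show "\<exists>l\<in>{1..n}. (Mut k, Mut l) \<in> quiver n \<xi>"
    proof
      assume "2 \<le> k \<and> slope k = 1"
      then show ?thesis using assms by (intro bexI[of _ "k - 1"]) (auto simp: Mut_Mut_quiver)
    next
      assume "slope (Suc k) = -1"
      then show ?thesis using assms by (intro bexI[of _ "Suc k"]) (simp_all add: Mut_Mut_quiver)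
    qed
  qed
  have left: "(\<exists>l\<in>{1..n}. (Mut l, Mut k) \<in> quiver n \<xi>) \<longleftrightarrow> 2 \<le> k \<and> slope k = -1 \<or> slope (Suc k) = 1"
  proof
    assume "\<exists>l\<in>{1..n}. (Mut l, Mut k) \<in> quiver n \<xi>"
    then show "2 \<le> k \<and> slope k = -1 \<or> slope (Suc k) = 1"
      by (auto simp: Mut_Mut_quiver)
  next
    assume "2 \<le> k \<and> slope k = -1 \<or> slope (Suc k) = 1"
    then show "\<exists>l\<in>{1..n}. (Mut l, Mut k) \<in> quiver n \<xi>"
    proof
      assume "2 \<le> k \<and> slope k = -1"
      then show ?thesis using assms by (intro bexI[of _ "k - 1"]) (auto simp: Mut_Mut_quiver)
    next
      assume "slope (Suc k) = 1"
      then show ?thesis using assms by (intro bexI[of _ "Suc k"]) (simp_all add: Mut_Mut_quiver)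
    qed
  qed
  have "slope k = 1 \<or> slope k = -1" using slope_cases[of k] assms by simp
  moreover have "sink_or_source n \<xi> k \<longleftrightarrow>
      \<not> (2 \<le> k \<and> slope k = 1 \<or> slope (Suc k) = -1) \<or> \<not> (2 \<le> k \<and> slope k = -1 \<or> slope (Suc k) = 1)"
    unfolding sink_or_source_def left[symmetric] right[symmetric] by blast
  moreover have "\<not> 2 \<le> k \<longleftrightarrow> k = 1" using assms by auto
  ultimately show ?thesis using slope_turn[OF assms] by (cases "turn k"; elim disjE) simp_all
qed

text \<open>This recursion has the same shape as that of \<open>minus_part\<close>, so the two can
  be compared by induction on \<open>j\<close>.\<close>

lemma bullet_Suc:
  assumes "1 \<le> j" "j < n"
  shows "bullet n \<xi> (Suc j) = (if j = 1 \<or> turn j then j else bullet n \<xi> j)"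
proof (cases "j = 1 \<or> turn j")
  case True
  have "Max {k. 1 \<le> k \<and> k < Suc j \<and> sink_or_source n \<xi> k} = j" if "2 \<le> j"
    using that True assms sink_or_source_iff[of j] by (intro Max_eqI) auto
  then show ?thesis using True assms by (auto simp: bullet_def)
next
  case False
  then have "\<not> sink_or_source n \<xi> j" using assms sink_or_source_iff by blast
  then have set_eq: "{k. 1 \<le> k \<and> k < Suc j \<and> sink_or_source n \<xi> k} = {k. 1 \<le> k \<and> k < j \<and> sink_or_source n \<xi> k}"
    by (auto simp: less_Suc_eq)
  \<comment> \<open>The separate clause \<open>bullet n \<xi> 2 = 1\<close> agrees with the general
    maximum, since vertex 1 always counts.\<close>
  have "Max {k. 1 \<le> k \<and> k < 2 \<and> sink_or_source n \<xi> k} = 1" if "2 \<le> n"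
    using that sink_or_source_iff[of 1] by (intro Max_eqI) auto
  then show ?thesis using False assms set_eq by (cases "j = 2") (auto simp: bullet_def)
qed

lemma bullet_less: "1 \<le> j \<Longrightarrow> j \<le> n \<Longrightarrow> bullet n \<xi> j < j"
proof (induction j rule: nat_induct_at_least)
  case base
  then show ?case by (simp add: bullet_def)
next
  case (Suc j)
  then show ?case using bullet_Suc[of j] by auto
qed

section \<open>Columns of the exchange matrix as signed differences of indicator functions\<close>

text \<open>The edges from \<open>j\<close> to \<open>j + 1\<close> and \<open>(j + 1)'\<close> never change before the mutation at \<open>j\<close>; the
  sets \<open>A\<close> and \<open>S\<close> are the positive and negative neighbours of \<open>j\<close> among the mutable vertices below
  \<open>j\<close> and the frozen vertices up to \<open>j'\<close>.\<close>

definition plus_side :: "nat \<Rightarrow> vertex set \<Rightarrow> vertex set" where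
  "plus_side j A = A \<union> (if turn j then {} else {Mut (Suc j)})"

definition minus_side :: "nat \<Rightarrow> vertex set \<Rightarrow> vertex set" where
  "minus_side j S = S \<union> (if turn j then (if j < n then {Mut (Suc j)} else {}) else {Fro (Suc j)})"

text \<open>The orientation enters through one overall sign, the slope. It swaps the two monomials
  of the exchange relation and so drops out there.\<close>

definition column :: "nat \<Rightarrow> vertex set \<Rightarrow> vertex set \<Rightarrow> vertex \<Rightarrow> int" where
  "column j A S u = slope j * (of_bool (u \<in> plus_side j A) - of_bool (u \<in> minus_side j S))"

definition left_neighbour :: "nat \<Rightarrow> vertex set" where
  "left_neighbour j = (if 2 \<le> j then {Mut (j - 1)} else {})"

definition before :: "nat \<Rightarrow> vertex set" where
  "before j = Mut ` {1..<j} \<union> Fro ` {1..j}"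

lemma matrix_of_quiver:
  assumes "1 \<le> j" "j \<le> n"
  shows "matrix_of (quiver n \<xi>) u (Mut j) = column j {Fro j} (left_neighbour j) u"
proof (cases u)
  case (Fro a)
  then show ?thesis using assms slope_cases[OF assms] turn_n
    by (elim disjE) (auto simp: matrix_of_def column_def plus_side_def minus_side_def
        left_neighbour_def Fro_Mut_quiver Mut_Fro_quiver)
next
  case (Mut a)
  consider "Suc a = j" | "a = Suc j" | "a \<noteq> Suc j" "Suc a \<noteq> j" by blast
  then show ?thesis
  proof cases
    case 1
    then show ?thesis using Mut assms slope_cases[OF assms]
      by (elim disjE) (auto simp: matrix_of_def column_def plus_side_def minus_side_def
        left_neighbour_def Mut_Mut_quiver)
  next
    case 2
    then show ?thesis
    proof (cases "j < n")
      case True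
      then show ?thesis using 2 Mut assms slope_cases[OF assms] slope_turn[of j]
        by (elim disjE) (auto simp: matrix_of_def column_def plus_side_def minus_side_def
          left_neighbour_def Mut_Mut_quiver)
    next
      case False
      then show ?thesis using 2 Mut assms turn_n
        by (auto simp: matrix_of_def column_def plus_side_def minus_side_def
          left_neighbour_def Mut_Mut_quiver)
    qed
  next
    case 3
    then show ?thesis using Mut
      by (auto simp: matrix_of_def column_def plus_side_def minus_side_def
        left_neighbour_def Mut_Mut_quiver)
  qed
qed

text \<open>Mutation adds \<open>- slope (Suc j)\<close> at those \<open>u\<close> whose entry in
  column \<open>j\<close> has the sign of \<open>- slope (Suc j)\<close>. At a turn these form
  \<open>A\<close>; otherwise they form \<open>S\<close> and \<open>Fro (Suc j)\<close>, and the
  latter cancels the initial entry of column \<open>j + 1\<close>. The entry at \<open>Mut j\<close>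
  changes sign.\<close>

lemma mutate_matrix_next_column:
  assumes j: "1 \<le> j" "j < n"
    and before: "A \<subseteq> before j" "S \<subseteq> before j" "A \<inter> S = {}"
    and col: "B u (Mut j) = column j A S u"
    and row: "B (Mut j) (Mut (Suc j)) = - slope (Suc j)"
    and "next": "B u (Mut (Suc j)) = column (Suc j) {Fro (Suc j)} {Mut j} u"
  shows "mutate_matrix (Mut j) B u (Mut (Suc j)) =
    column (Suc j) (insert (Mut j) (if turn j then {Fro (Suc j)} else {})) (if turn j then A else S) u"
proof (cases "u = Mut j")
  case True
  have "Mut j \<notin> A" "Mut j \<notin> S" using before by (auto simp: before_def)
  then show ?thesis using True row by (simp add: column_def plus_side_def minus_side_def)
next
  case False
  have notin: "Mut (Suc j) \<notin> A" "Mut (Suc j) \<notin> S" "Mut (Suc (Suc j)) \<notin> A" "Mut (Suc (Suc j)) \<notin> S"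
    "Fro (Suc j) \<notin> A" "Fro (Suc j) \<notin> S" "Fro (Suc (Suc j)) \<notin> A" "Fro (Suc (Suc j)) \<notin> S"
    "u \<notin> A \<or> u \<notin> S"
    using before by (auto simp: before_def)
  have "slope j = 1 \<or> slope j = -1" using slope_cases[of j] j by simp
  then show ?thesis
    using False notin j unfolding mutate_matrix.simps col row "next" slope_turn[OF j]
    by (cases "turn j"; elim disjE)
      (auto simp: column_def plus_side_def minus_side_def slope_turn split: if_splits)
qed

end

section \<open>Mutation along an interval\<close>

text \<open>As \<open>P\<close> and \<open>N\<close> are disjoint, truncation by \<open>nat\<close>
  leaves exponent 1 exactly on \<open>P\<close> in one product and on \<open>N\<close> in the other.
  The sign \<open>s\<close> decides which is which.\<close>

lemma mutate_exchange:
  fixes y :: "vertex \<Rightarrow> 'a::field"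
  assumes col: "\<And>u. B u w = s * (of_bool (u \<in> P) - of_bool (u \<in> N))"
    and skew: "\<And>u. B w u = - B u w"
    and s: "s = 1 \<or> s = -1"
    and sub: "P \<subseteq> vertices n" "N \<subseteq> vertices n" and disj: "P \<inter> N = {}"
  shows "fst (mutate n w (y, B)) w = (prod y P + prod y N) / y w"
proof -
  have fin: "finite (vertices n)" by (simp add: vertices_def)
  have *: "(\<Prod>v\<in>vertices n. y v ^ nat (of_bool (v \<in> P) - of_bool (v \<in> N))) = prod y P"
    if "P \<subseteq> vertices n" "P \<inter> N = {}" for P N
    using that fin by (intro prod.mono_neutral_cong_right) auto
  have eq: "- (of_bool (v \<in> P) - of_bool (v \<in> N)) = (of_bool (v \<in> N) - of_bool (v \<in> P) :: int)" for v
    by simp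
  have disj': "N \<inter> P = {}" using disj by blast
  show ?thesis using s
  proof
    assume s: "s = 1"
    show ?thesis using *[OF sub(1) disj] *[OF sub(2) disj']
      unfolding mutate_def by (simp add: skew col s eq)
  next
    assume s: "s = -1"
    show ?thesis using *[OF sub(1) disj] *[OF sub(2) disj']
      unfolding mutate_def by (simp add: skew col s eq)
  qed
qed

lemma mutate_fst_other: "v \<noteq> w \<Longrightarrow> fst (mutate n w s) v = fst s v"
  by (simp add: mutate_def split: prod.splits)

lemma mutate_snd: "snd (mutate n w s) = mutate_matrix w (snd s)"
  by (simp add: mutate_def split: prod.splits)

lemma mutate_matrix_skew:
  "(\<And>u v. B u v = - B v u) \<Longrightarrow> mutate_matrix w B u v = - mutate_matrix w B v u"
proof -
  assume skew: "\<And>u v. B u v = - B v u"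
  have "B u w = - B w u" "B w v = - B v w" "B u v = - B v u" by (rule skew)+
  then show ?thesis by auto
qed

context height_quiver
begin

text \<open>For \<open>j > i\<close>, the mutation at \<open>j - 1\<close> has reversed the edge
  between \<open>j - 1\<close> and \<open>j\<close> and has cancelled the one between
  \<open>Fro j\<close> and \<open>j\<close> unless \<open>j - 1\<close> is a turn.\<close>

definition plus_part :: "nat \<Rightarrow> nat \<Rightarrow> vertex set" where
  "plus_part i j =
     (if j = i then {Fro i} else insert (Mut (j - 1)) (if turn (j - 1) then {Fro j} else {}))"

text \<open>Up to index \<open>i\<close> the value is a default, chosen to give the initial left
  neighbour at \<open>i\<close>.\<close>

primrec minus_part :: "nat \<Rightarrow> nat \<Rightarrow> vertex set" where
  "minus_part i 0 = left_neighbour i"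
| "minus_part i (Suc j) =
     (if j < i then left_neighbour i else if turn j then plus_part i j else minus_part i j)"

lemma minus_part_self: "minus_part i i = left_neighbour i"
  by (cases i) auto

lemma before_mono: "i \<le> j \<Longrightarrow> before i \<subseteq> before j"
  by (auto simp: before_def)

lemma before_subset_vertices: "j \<le> n \<Longrightarrow> before j \<subseteq> vertices n"
  by (auto simp: before_def vertices_def)

lemma plus_part_before: "1 \<le> i \<Longrightarrow> i \<le> j \<Longrightarrow> plus_part i j \<subseteq> before j"
  by (auto simp: plus_part_def before_def)

lemma minus_part_before:
  assumes "1 \<le> i" "i \<le> j"
  shows "minus_part i j \<subseteq> before j"
  using assms(2)
proof (induction j rule: dec_induct)
  case base
  show ?case using assms(1) by (auto simp: minus_part_self left_neighbour_def before_def)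
next
  case (step j)
  then show ?case using assms(1) plus_part_before[of i j] before_mono[of j "Suc j"] by auto
qed

text \<open>For \<open>j > i\<close> the negative part lies in \<open>before (j - 1)\<close>,
  whereas the positive part contains at most \<open>Mut (j - 1)\<close> and \<open>Fro j\<close>,
  both outside that set.\<close>

lemma plus_minus_disjoint:
  assumes "1 \<le> i" "i \<le> j"
  shows "plus_part i j \<inter> minus_part i j = {}"
proof (cases "j = i")
  case True
  then show ?thesis using assms by (auto simp: minus_part_self plus_part_def left_neighbour_def)
next
  case False
  then obtain k where k: "j = Suc k" "i \<le> k" using assms by (cases j) auto
  then have "minus_part i j \<subseteq> before k"
    using assms plus_part_before[of i k] minus_part_before[of i k] by simp
  then show ?thesis using k by (auto simp: plus_part_def before_def)
qed

section \<open>Seeds met while mutating at \<open>i\<close>, \<open>i + 1\<close> and so on\<close>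

definition seed :: "(nat \<Rightarrow> 'a::field) \<Rightarrow> (nat \<Rightarrow> 'a) \<Rightarrow> nat \<Rightarrow> nat \<Rightarrow> 'a seed" where
  "seed x f i m = fold (\<lambda>k. mutate n (Mut k)) [i..<m] (initial_seed n \<xi> x f)"

lemma seed_start: "seed x f i i = initial_seed n \<xi> x f"
  by (simp add: seed_def)

lemma seed_Suc: "i \<le> m \<Longrightarrow> seed x f i (Suc m) = mutate n (Mut m) (seed x f i m)"
  by (simp add: seed_def)

lemma root_variable_seed: "i \<le> j \<Longrightarrow> root_variable n \<xi> x f i j = fst (seed x f i (Suc j)) (Mut j)"
  by (simp add: root_variable_def seed_def)

lemma seed_skew: "i \<le> m \<Longrightarrow> snd (seed x f i m) u v = - snd (seed x f i m) v u"
proof (induction m arbitrary: u v rule: dec_induct)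
  case base
  show ?case by (simp add: seed_start initial_seed_def matrix_of_def)
next
  case (step m)
  show ?case unfolding seed_Suc[OF step.hyps(1)] mutate_snd by (rule mutate_matrix_skew[OF step.IH])
qed

text \<open>The two claims are proved together: the column next in line is still the initial one,
  which is what \<open>mutate_matrix_next_column\<close> requires.\<close>

lemma seed_columns:
  assumes "1 \<le> i" "i \<le> m" "m \<le> n"
  shows "snd (seed x f i m) u (Mut m) = column m (plus_part i m) (minus_part i m) u"
    and "m < k \<Longrightarrow> k \<le> n \<Longrightarrow> snd (seed x f i m) u (Mut k) = column k {Fro k} {Mut (k - 1)} u"
proof -
  have "m \<le> n \<longrightarrow>
      (\<forall>u. snd (seed x f i m) u (Mut m) = column m (plus_part i m) (minus_part i m) u) \<and>
      (\<forall>u k. m < k \<longrightarrow> k \<le> n \<longrightarrow> snd (seed x f i m) u (Mut k) = column k {Fro k} {Mut (k - 1)} u)"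
    using assms(2)
  proof (induction m rule: dec_induct)
    case base
    show ?case using assms(1)
      by (auto simp: seed_start initial_seed_def matrix_of_quiver plus_part_def minus_part_self left_neighbour_def)
  next
    case (step m)
    let ?B = "snd (seed x f i m)"
    show ?case
    proof (intro impI conjI allI)
      assume "Suc m \<le> n"
      then have current: "?B u (Mut m) = column m (plus_part i m) (minus_part i m) u"
        and later: "m < k \<Longrightarrow> k \<le> n \<Longrightarrow> ?B u (Mut k) = column k {Fro k} {Mut (k - 1)} u" for u k
        using step.IH by auto
      {
        fix u
        have "?B (Mut m) (Mut (Suc m)) = - slope (Suc m)"
          using later[of "Suc m" "Mut m"] \<open>Suc m \<le> n\<close>
          by (simp add: column_def plus_side_def minus_side_def)
        moreover have "?B u (Mut (Suc m)) = column (Suc m) {Fro (Suc m)} {Mut m} u"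
          using later[of "Suc m" u] \<open>Suc m \<le> n\<close> by simp
        moreover have "1 \<le> m" "m < n" using assms(1) step.hyps \<open>Suc m \<le> n\<close> by auto
        ultimately have "mutate_matrix (Mut m) ?B u (Mut (Suc m)) =
          column (Suc m) (insert (Mut m) (if turn m then {Fro (Suc m)} else {}))
            (if turn m then plus_part i m else minus_part i m) u"
          using plus_part_before minus_part_before plus_minus_disjoint assms(1) step.hyps(1) current
          by (intro mutate_matrix_next_column) auto
        then show "snd (seed x f i (Suc m)) u (Mut (Suc m)) =
          column (Suc m) (plus_part i (Suc m)) (minus_part i (Suc m)) u"
          using step.hyps(1) by (simp add: seed_Suc mutate_snd plus_part_def del: mutate_matrix.simps)
      next
        fix u k
        assume k: "Suc m < k" "k \<le> n"
        \<comment> \<open>Vertices \<open>m\<close> and \<open>k\<close> are not adjacent, so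
          mutation at \<open>m\<close> leaves column \<open>k\<close> unchanged.\<close>
        then have "m \<noteq> k - 1" by simp
        then have "?B (Mut m) (Mut k) = 0"
          using k later[of k "Mut m"] by (simp add: column_def plus_side_def minus_side_def)
        then show "snd (seed x f i (Suc m)) u (Mut k) = column k {Fro k} {Mut (k - 1)} u"
          using later[of k u] later[of k "Mut m"] k step.hyps(1) by (auto simp: seed_Suc mutate_snd)
      }
    qed
  qed
  then show "snd (seed x f i m) u (Mut m) = column m (plus_part i m) (minus_part i m) u"
    and "m < k \<Longrightarrow> k \<le> n \<Longrightarrow> snd (seed x f i m) u (Mut k) = column k {Fro k} {Mut (k - 1)} u"
    using assms(3) by auto
qed

end

section \<open>Exchange relations\<close>

locale height_quiver_cluster = height_quiver n \<xi> for n \<xi> +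
  fixes x f :: "nat \<Rightarrow> 'a::field_char_0"
  assumes x_0: "x 0 = 1" and x_last: "x (Suc n) = 1"
    and x_nonzero: "\<And>k. 1 \<le> k \<Longrightarrow> k \<le> n \<Longrightarrow> x k \<noteq> 0"
begin

section \<open>Exchange relations for the root variables\<close>

abbreviation X :: "nat \<Rightarrow> nat \<Rightarrow> 'a" where
  "X \<equiv> root_variable n \<xi> x f"

abbreviation d :: "nat \<Rightarrow> nat" where
  "d \<equiv> dlt n \<xi>"

lemma d_eq: "d j = of_bool (turn j)"
  by (simp add: dlt_def turn_def)

text \<open>In \<open>seed x f i m\<close> the variable at \<open>k\<close> is new only for
  \<open>i \<le> k < m\<close>. Without the upper bound a single assignment serves all stages; it is
  correct on \<open>before m\<close>.\<close>

fun cluster_value :: "nat \<Rightarrow> vertex \<Rightarrow> 'a" where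
  "cluster_value i (Mut k) = (if i \<le> k then X i k else x k)"
| "cluster_value i (Fro k) = f k"

lemma seed_cluster:
  assumes "i \<le> m"
  shows "fst (seed x f i m) v =
    (case v of Mut k \<Rightarrow> if i \<le> k \<and> k < m then X i k else x k | Fro k \<Rightarrow> f k)"
  using assms
proof (induction m rule: dec_induct)
  case base
  show ?case by (auto simp: seed_start initial_seed_def split: vertex.split)
next
  case (step m)
  show ?case
  proof (cases "v = Mut m")
    case True
    then show ?thesis using step.hyps by (simp add: root_variable_seed)
  next
    case False
    then show ?thesis using step by (auto simp: seed_Suc mutate_fst_other split: vertex.split)
  qed
qed

lemma exchange_relation:
  assumes "1 \<le> i" "i \<le> j" "j \<le> n"
  shows "x j * X i j =
    prod (cluster_value i) (plus_part i j) * x (Suc j) ^ (1 - d j)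
    + f (Suc j) ^ (1 - d j) * x (Suc j) ^ d j * prod (cluster_value i) (minus_part i j)"
proof -
  let ?y = "fst (seed x f i j)" and ?B = "snd (seed x f i j)"
  let ?P = "plus_part i j" and ?N = "minus_part i j"
  have before: "?P \<subseteq> before j" "?N \<subseteq> before j" and disj: "?P \<inter> ?N = {}"
    using assms plus_part_before minus_part_before plus_minus_disjoint by auto
  have notin: "Mut (Suc j) \<notin> before j" "Fro (Suc j) \<notin> before j" by (auto simp: before_def)
  have fin: "finite ?P" "finite ?N"
    using before by (auto simp: before_def intro: finite_subset)
  have "1 \<le> j" using assms by simp
  \<comment> \<open>Since \<open>n\<close> is a turn, a vertex that is not a turn has a right
    neighbour, mutable and frozen.\<close>
  have "j < n" if "\<not> turn j" using that turn_n assms by (cases "j = n") auto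
  then have sub: "plus_side j ?P \<subseteq> vertices n" "minus_side j ?N \<subseteq> vertices n"
    using before before_subset_vertices[OF assms(3)]
    by (auto simp: plus_side_def minus_side_def vertices_def)
  have disj': "plus_side j ?P \<inter> minus_side j ?N = {}"
    using before disj notin by (auto simp: plus_side_def minus_side_def)
  have "X i j = fst (mutate n (Mut j) (?y, ?B)) (Mut j)"
    using assms by (simp add: root_variable_seed seed_Suc)
  also have "\<dots> = (prod ?y (plus_side j ?P) + prod ?y (minus_side j ?N)) / ?y (Mut j)"
  proof (rule mutate_exchange[OF _ _ slope_cases[OF \<open>1 \<le> j\<close> assms(3)] sub disj'])
    show "?B u (Mut j) = slope j * (of_bool (u \<in> plus_side j ?P) - of_bool (u \<in> minus_side j ?N))" for u
      using seed_columns(1)[OF assms, of x f u] unfolding column_def .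
    show "?B (Mut j) u = - ?B u (Mut j)" for u
      by (rule seed_skew[OF assms(2)])
  qed
  finally have X: "x j * X i j = prod ?y (plus_side j ?P) + prod ?y (minus_side j ?N)"
    using assms x_nonzero[of j] by (simp add: seed_cluster)
  have "prod ?y A = prod (cluster_value i) A" if "A \<subseteq> before j" for A
    using that assms by (intro prod.cong) (auto simp: before_def seed_cluster)
  then have P: "prod ?y ?P = prod (cluster_value i) ?P" and N: "prod ?y ?N = prod (cluster_value i) ?N"
    using before by auto
  have notin: "Mut (Suc j) \<notin> ?P" "Mut (Suc j) \<notin> ?N" "Fro (Suc j) \<notin> ?N"
    using before notin by auto
  have "prod ?y (plus_side j ?P) = prod ?y ?P * x (Suc j) ^ (1 - d j)"
    using fin notin by (simp add: plus_side_def d_eq seed_cluster[OF assms(2)] mult.commute)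
  moreover have "prod ?y (minus_side j ?N) =
      f (Suc j) ^ (1 - d j) * x (Suc j) ^ d j * prod ?y ?N"
  proof (cases "j = n")
    case True
    \<comment> \<open>There is no vertex \<open>n + 1\<close>; its factor in the formula is
      \<open>x (Suc n) = 1\<close>.\<close>
    then show ?thesis using turn_n x_last by (simp add: minus_side_def d_eq)
  next
    case False
    then show ?thesis using fin notin assms
      by (simp add: minus_side_def d_eq seed_cluster[OF assms(2)])
  qed
  ultimately show ?thesis using X P N by simp
qed

lemma prod_plus_part_self: "prod (cluster_value i) (plus_part i i) = f i"
  by (simp add: plus_part_def)

lemma prod_plus_part_Suc:
  "i \<le> j \<Longrightarrow> prod (cluster_value i) (plus_part i (Suc j)) = X i j * f (Suc j) ^ d j"
  by (auto simp: plus_part_def d_eq)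

lemma prod_minus_part_self: "1 \<le> i \<Longrightarrow> prod (cluster_value i) (minus_part i i) = x (i - 1)"
  using x_0 by (cases "i = 1") (auto simp: minus_part_self left_neighbour_def)

text \<open>Beyond \<open>i\<close>, \<open>minus_part\<close> and \<open>bullet\<close> change at
  turns only. If \<open>b j\<close> lies below \<open>i\<close>, then \<open>b j = b i\<close> and
  the left neighbour of \<open>i\<close> is still inherited; if \<open>b j\<close> lies above
  \<open>i\<close>, the part is \<open>plus_part i (b j)\<close>. The two indicators exclude each
  other because \<open>b i < i\<close>.\<close>

lemma prod_minus_part:
  defines "b \<equiv> bullet n \<xi>"
  assumes "1 \<le> i" "i < j" "j \<le> n"
  shows "prod (cluster_value i) (minus_part i j) =
    (of_bool (b i = b j) + of_bool (i = b j))
      * f i ^ (of_bool (i = b j) * d i) * x (i - 1) ^ (1 - of_bool (i = b j))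
    + (1 - of_bool (b i = b j) - of_bool (i = b j))
      * f (b j) ^ d (b j - 1) * X i (b j - 1)"
proof -
  have "Suc i \<le> j" using assms by simp
  then show ?thesis using assms(4)
  proof (induction j rule: dec_induct)
    case base
    have "b i < i" using bullet_less[of i] base assms by (simp add: b_def)
    moreover have "b (Suc i) = (if i = 1 \<or> turn i then i else b i)"
      using bullet_Suc[of i] base assms by (simp add: b_def)
    \<comment> \<open>If \<open>i = 1\<close> is not a turn, still \<open>b 2 = 1\<close>, but the
      inherited part is the empty left neighbour. The exponent \<open>d i = 0\<close> yields its
      product 1.\<close>
    ultimately show ?case
      using assms x_0
      by (cases "turn i"; cases "i = 1") (simp_all add: prod_plus_part_self prod_minus_part_self left_neighbour_def d_eq)
  next
    case (step j)
    have "b i < i" using bullet_less[of i] step.hyps step.prems assms by (simp add: b_def)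
    have bullet: "b (Suc j) = (if turn j then j else b j)"
      using bullet_Suc[of j] step.hyps step.prems assms by (simp add: b_def)
    obtain k where k: "j = Suc k" "i \<le> k" using step.hyps by (cases j) auto
    show ?case
    proof (cases "turn j")
      case True
      then show ?thesis
        using bullet k \<open>b i < i\<close> by (simp add: prod_plus_part_Suc mult.commute)
    next
      case False
      then show ?thesis
        using bullet step.IH step.hyps step.prems by simp
    qed
  qed
qed

end

section \<open>Denominators\<close>

lemma poly_eval_superset:
  assumes "finite M" "Poly_Mapping.keys p \<subseteq> M"
  shows "poly_eval of_int y p = (\<Sum>m\<in>M. of_int (Poly_Mapping.lookup p m) *
    (\<Prod>v\<in>Poly_Mapping.keys m. y v ^ Poly_Mapping.lookup m v))"
  unfolding poly_eval_def using assms
  by (intro sum.mono_neutral_left) (auto simp: in_keys_iff)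

lemma poly_eval_0 [simp]: "poly_eval of_int y 0 = 0"
  by (simp add: poly_eval_def)

lemma poly_eval_1 [simp]: "poly_eval of_int y 1 = 1"
  by (simp add: poly_eval_def flip: single_one)

lemma poly_eval_single:
  "poly_eval of_int y (Poly_Mapping.single m c) =
    of_int c * (\<Prod>v\<in>Poly_Mapping.keys m. y v ^ Poly_Mapping.lookup m v)"
  by (simp add: poly_eval_def)

lemma poly_eval_add: "poly_eval of_int y (p + q) = poly_eval of_int y p + poly_eval of_int y q"
proof -
  let ?M = "Poly_Mapping.keys p \<union> Poly_Mapping.keys q"
  have "poly_eval of_int y r = (\<Sum>m\<in>?M. of_int (Poly_Mapping.lookup r m) *
      (\<Prod>v\<in>Poly_Mapping.keys m. y v ^ Poly_Mapping.lookup m v))" if "r \<in> {p, q, p + q}" for r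
    using that Poly_Mapping.keys_add[of p q] by (intro poly_eval_superset) auto
  then show ?thesis by (simp add: lookup_add sum.distrib ring_distribs)
qed

lemma poly_eval_sum: "poly_eval of_int y (sum p M) = (\<Sum>m\<in>M. poly_eval of_int y (p m))"
  by (induction M rule: infinite_finite_induct) (simp_all add: poly_eval_add)

lemma poly_mapping_eq_sum_single:
  "p = (\<Sum>m\<in>Poly_Mapping.keys p. Poly_Mapping.single m (Poly_Mapping.lookup p m))"
  by (rule poly_mapping_eqI) (simp add: lookup_sum lookup_single when_def in_keys_iff)

text \<open>Multiplication by a variable can enlarge the support of a monomial, so all products are
  taken over the common index set \<open>?K\<close>.\<close>

lemma monomial_eval_var_add:
  fixes y :: "vertex \<Rightarrow> 'a::field"
  shows "(\<Prod>v\<in>Poly_Mapping.keys (Poly_Mapping.single w 1 + m).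
      y v ^ Poly_Mapping.lookup (Poly_Mapping.single w 1 + m) v) =
    y w * (\<Prod>v\<in>Poly_Mapping.keys m. y v ^ Poly_Mapping.lookup m v)"
    (is "?L = _ * ?R")
proof -
  let ?K = "insert w (Poly_Mapping.keys m)"
  have keys: "Poly_Mapping.keys (Poly_Mapping.single w 1 + m) = ?K"
    by (auto simp: in_keys_iff lookup_add lookup_single when_def split: if_splits)
  have "?L = (\<Prod>v\<in>?K. y v ^ (1 when w = v) * y v ^ Poly_Mapping.lookup m v)"
    unfolding keys by (simp add: lookup_add lookup_single power_add)
  also have "\<dots> = (\<Prod>v\<in>?K. y v ^ (1 when w = v)) * (\<Prod>v\<in>?K. y v ^ Poly_Mapping.lookup m v)"
    by (rule prod.distrib)
  also have "(\<Prod>v\<in>?K. y v ^ (1 when w = v)) = (\<Prod>v\<in>?K. if w = v then y v else 1)"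
    by (intro prod.cong) (auto simp: when_def)
  also have "\<dots> = y w" by simp
  also have "(\<Prod>v\<in>?K. y v ^ Poly_Mapping.lookup m v) = ?R"
    by (intro prod.mono_neutral_right) (auto simp: in_keys_iff)
  finally show ?thesis .
qed

text \<open>Additivity reduces this to a single term. Numerators are built from 1 by sums and by
  multiplication with variables, so this form of multiplicativity suffices.\<close>

lemma poly_eval_var_mult: "poly_eval of_int y (poly_var w * p) = y w * poly_eval of_int y p"
proof -
  let ?s = "\<lambda>m. Poly_Mapping.single m (Poly_Mapping.lookup p m)"
  have "poly_var w * p = (\<Sum>m\<in>Poly_Mapping.keys p. poly_var w * ?s m)"
    by (subst poly_mapping_eq_sum_single[of p]) (rule sum_distrib_left)
  moreover have "poly_eval of_int y (poly_var w * ?s m) = y w * poly_eval of_int y (?s m)" for m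
    by (simp only: poly_var_def mult_single poly_eval_single monomial_eval_var_add) simp
  ultimately have "poly_eval of_int y (poly_var w * p) =
      y w * poly_eval of_int y (\<Sum>m\<in>Poly_Mapping.keys p. ?s m)"
    by (simp add: poly_eval_sum sum_distrib_left)
  then show ?thesis by (simp flip: poly_mapping_eq_sum_single)
qed

lemma poly_in_add: "poly_in V p \<Longrightarrow> poly_in V q \<Longrightarrow> poly_in V (p + q)"
  using Poly_Mapping.keys_add[of p q] by (auto simp: poly_in_def)

lemma poly_in_var_mult:
  assumes "w \<in> V" "poly_in V p"
  shows "poly_in V (poly_var w * p)"
  unfolding poly_in_def
proof
  fix m assume "m \<in> Poly_Mapping.keys (poly_var w * p)"
  then obtain m' where "m = Poly_Mapping.single w 1 + m'" "m' \<in> Poly_Mapping.keys p"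
    using Poly_Mapping.keys_mult[of "poly_var w" p] by (auto simp: poly_var_def)
  then show "Poly_Mapping.keys m \<subseteq> V"
    using assms Poly_Mapping.keys_add[of "Poly_Mapping.single w 1" m'] by (auto simp: poly_in_def)
qed

text \<open>A test point: a multiple of the variable at \<open>Mut k\<close> vanishes here, so a
  positive value refutes divisibility.\<close>

definition off :: "nat \<Rightarrow> vertex \<Rightarrow> rat" where
  "off k v = of_bool (v \<noteq> Mut k)"

text \<open>\<open>K\<close> contains the indices of all variables \<open>x k\<close> that may divide the polynomial.\<close>

definition numerator :: "nat \<Rightarrow> (vertex \<Rightarrow> 'a::field_char_0) \<Rightarrow> nat set \<Rightarrow> 'a \<Rightarrow> bool" where
  "numerator n y K z \<longleftrightarrow>
     (\<exists>p. poly_in (vertices n) p \<and> poly_eval of_int y p = z \<and>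
        (\<forall>k. 0 \<le> poly_eval of_int (off k) p \<and> (k \<notin> K \<longrightarrow> 0 < poly_eval of_int (off k) p)))"

lemma numerator_1: "numerator n y K 1"
  unfolding numerator_def by (intro exI[of _ 1]) (auto simp: poly_in_def)

lemma numerator_mono: "numerator n y K z \<Longrightarrow> K \<subseteq> L \<Longrightarrow> numerator n y L z"
  unfolding numerator_def by blast

text \<open>Both values at a test point are nonnegative, so one positive summand makes the sum
  positive.\<close>

lemma numerator_add:
  assumes "numerator n y K z" "numerator n y L w"
  shows "numerator n y (K \<inter> L) (z + w)"
proof -
  from assms obtain p q where
    "poly_in (vertices n) p" "poly_eval of_int y p = z"
    "\<And>k. 0 \<le> poly_eval of_int (off k) p" "\<And>k. k \<notin> K \<Longrightarrow> 0 < poly_eval of_int (off k) p"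
    "poly_in (vertices n) q" "poly_eval of_int y q = w"
    "\<And>k. 0 \<le> poly_eval of_int (off k) q" "\<And>k. k \<notin> L \<Longrightarrow> 0 < poly_eval of_int (off k) q"
    unfolding numerator_def by blast
  then show ?thesis unfolding numerator_def
    by (intro exI[of _ "p + q"])
      (auto simp: poly_in_add poly_eval_add intro: add_pos_nonneg add_nonneg_pos)
qed

lemma numerator_mult_var:
  assumes "numerator n y K z" "w \<in> vertices n"
  shows "numerator n y (K \<union> {k. w = Mut k}) (y w * z)"
proof -
  from assms obtain p where
    "poly_in (vertices n) p" "poly_eval of_int y p = z"
    "\<And>k. 0 \<le> poly_eval of_int (off k) p" "\<And>k. k \<notin> K \<Longrightarrow> 0 < poly_eval of_int (off k) p"
    unfolding numerator_def by blast
  then show ?thesis unfolding numerator_def using assms(2)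
    by (intro exI[of _ "poly_var w * p"]) (auto simp: poly_in_var_mult poly_eval_var_mult off_def)
qed

lemma numerator_has_denominator:
  assumes "numerator n (initial_cluster x f) {} (z * (\<Prod>k=1..n. x k ^ a k))"
  shows "has_denominator n x f a z"
proof -
  from assms obtain p where p: "poly_in (vertices n) p"
    "poly_eval of_int (initial_cluster x f) p = z * (\<Prod>k=1..n. x k ^ a k)"
    and pos: "\<And>k. 0 < poly_eval of_int (off k) p"
    unfolding numerator_def by blast
  have "\<not> poly_var (Mut k) dvd p" for k
  proof
    assume "poly_var (Mut k) dvd p"
    then obtain q where "p = poly_var (Mut k) * q" by (elim dvdE)
    then show False using pos[of k] by (simp add: poly_eval_var_mult off_def)
  qed
  then show ?thesis unfolding has_denominator_def
    using p by (intro exI[of _ p] exI[of _ "\<lambda>_. 0"]) simp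
qed

lemma algebraically_independent_nonzero:
  assumes "algebraically_independent V y" "v \<in> V"
  shows "y v \<noteq> 0"
proof
  assume "y v = 0"
  define p :: "(vertex \<Rightarrow>\<^sub>0 nat) \<Rightarrow>\<^sub>0 rat" where "p = Poly_Mapping.single (Poly_Mapping.single v 1) 1"
  have "poly_in V p" "poly_eval of_rat y p = 0"
    using assms(2) \<open>y v = 0\<close> by (simp_all add: poly_in_def poly_eval_def p_def)
  then have "p = 0" using assms(1) by (simp add: algebraically_independent_def)
  then have "Poly_Mapping.lookup p (Poly_Mapping.single v 1) = 0" by simp
  then show False by (simp add: p_def)
qed

lemma reachable_fold_mutate:
  "reachable n s t \<Longrightarrow> set ks \<subseteq> {1..n} \<Longrightarrow> reachable n s (fold (\<lambda>k. mutate n (Mut k)) ks t)"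
proof (induction ks arbitrary: t)
  case Nil
  then show ?case by simp
next
  case (Cons k ks)
  then have "reachable n s (mutate n (Mut k) t)" by (intro reachable.step) simp_all
  then show ?case using Cons by simp
qed

lemma prod_root_coeff:
  fixes x :: "nat \<Rightarrow> 'a::comm_monoid_mult"
  assumes "1 \<le> i" "i \<le> j" "j \<le> n"
  shows "(\<Prod>k=1..n. x k ^ root_coeff i j k) = prod x {i..j}"
  using assms by (intro prod.mono_neutral_cong_right) (auto simp: root_coeff_def)

section \<open>Denominators of the root variables\<close>

context height_quiver_cluster
begin

abbreviation num :: "nat set \<Rightarrow> 'a \<Rightarrow> bool" where
  "num \<equiv> numerator n (initial_cluster x f)"

lemma numerator_mult_x:
  assumes "num K z" "k \<le> Suc n"
  shows "num (insert k K) (x k * z)"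
proof -
  consider "k = 0" | "k = Suc n" | "1 \<le> k" "k \<le> n" using assms(2) by linarith
  then show ?thesis
  proof cases
    case 3
    then show ?thesis
      using numerator_mult_var[OF assms(1), of "Mut k"] by (simp add: vertices_def)
  qed (use assms(1) x_0 x_last in \<open>auto intro: numerator_mono\<close>)
qed

lemma numerator_mult_f_power:
  assumes "num K z" "0 < e \<Longrightarrow> 1 \<le> k \<and> k \<le> n"
  shows "num K (f k ^ e * z)"
  using assms(2)
proof (induction e)
  case 0
  then show ?case using assms(1) by simp
next
  case (Suc e)
  then have "num K (f k ^ e * z)" "Fro k \<in> vertices n" by (auto simp: vertices_def)
  from numerator_mult_var[OF this] show ?case by (simp add: mult.assoc)
qed

text \<open>Since \<open>d j\<close> is 0 or 1, \<open>x (Suc j)\<close> multiplies exactly one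
  summand. At a turn the first summand keeps the empty set of possible divisors; otherwise the sets
  are \<open>{Suc j}\<close> and \<open>{..<j}\<close>, which are disjoint.\<close>

lemma numerator_root_variable_step:
  assumes "1 \<le> i" "i \<le> j" "j \<le> n"
    and plus: "num {} (prod (cluster_value i) (plus_part i j) * prod x {i..<j})"
    and minus: "num {..<j} (prod (cluster_value i) (minus_part i j) * prod x {i..<j})"
  shows "num {} (X i j * prod x {i..j})"
proof -
  let ?P = "prod (cluster_value i) (plus_part i j) * prod x {i..<j}"
  let ?N = "prod (cluster_value i) (minus_part i j) * prod x {i..<j}"
  have split: "prod x {i..j} = prod x {i..<j} * x j"
    using assms(2) by (simp add: atLeastLessThanSuc_atLeastAtMost[symmetric])
  have "X i j * prod x {i..j} = prod x {i..<j} * (x j * X i j)"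
    unfolding split by (simp add: mult_ac)
  also have "\<dots> = x (Suc j) ^ (1 - d j) * ?P + f (Suc j) ^ (1 - d j) * (x (Suc j) ^ d j * ?N)"
    unfolding exchange_relation[OF assms(1-3)] by (simp add: algebra_simps)
  finally have eq: "X i j * prod x {i..j} = \<dots>" .
  show ?thesis
  proof (cases "turn j")
    case True
    then show ?thesis
      using numerator_add[OF plus numerator_mult_x[OF minus, of "Suc j"]] assms(3) eq
      by (simp add: d_eq)
  next
    case False
    then have "j < n" using turn_n assms(3) by (cases "j = n") auto
    then have "num {..<j} (f (Suc j) ^ 1 * ?N)"
      by (intro numerator_mult_f_power minus) simp
    from numerator_add[OF numerator_mult_x[OF plus, of "Suc j"] this]
    show ?thesis using False assms(3) eq by (simp add: d_eq)
  qed
qed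

text \<open>Passing to \<open>j + 1\<close> brings in the factor \<open>x j\<close>. In the positive
  part it clears the denominator of \<open>X i j\<close>; in the negative part it remains as a
  possible divisor, whence the bound grows to \<open>{..<Suc j}\<close>.\<close>

lemma numerator_parts:
  assumes "1 \<le> i" "i \<le> j" "j \<le> n"
  shows "num {} (prod (cluster_value i) (plus_part i j) * prod x {i..<j}) \<and>
    num {..<j} (prod (cluster_value i) (minus_part i j) * prod x {i..<j})"
  using assms(2,3)
proof (induction j rule: dec_induct)
  case base
  have "num {} (f i ^ 1 * 1)" using base assms(1) by (intro numerator_mult_f_power numerator_1) simp
  moreover have "num {..<i} (x (i - 1) * 1)"
    using base assms(1)
    by (intro numerator_mono[OF numerator_mult_x[OF numerator_1[of _ _ "{}"]]]) auto
  ultimately show ?case using assms(1) by (simp add: prod_plus_part_self prod_minus_part_self)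
next
  case (step j)
  then have plus: "num {} (prod (cluster_value i) (plus_part i j) * prod x {i..<j})"
    and minus: "num {..<j} (prod (cluster_value i) (minus_part i j) * prod x {i..<j})"
    and j: "i \<le> j" "j < n" by auto
  have "num {} (f (Suc j) ^ d j * (X i j * prod x {i..j}))"
    using numerator_root_variable_step[OF assms(1) _ _ plus minus] j
    by (intro numerator_mult_f_power) auto
  then have "num {} (prod (cluster_value i) (plus_part i (Suc j)) * prod x {i..<Suc j})"
    using j by (simp add: prod_plus_part_Suc atLeastLessThanSuc_atLeastAtMost mult_ac)
  moreover have "num {..<Suc j} (prod (cluster_value i) (minus_part i (Suc j)) * prod x {i..<Suc j})"
  proof (cases "turn j")
    case True
    have "num {..<Suc j} (x j * (prod (cluster_value i) (plus_part i j) * prod x {i..<j}))"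
      using numerator_mult_x[OF plus, of j] j by (auto intro: numerator_mono)
    then show ?thesis using True j by (simp add: mult_ac)
  next
    case False
    have "num {..<Suc j} (x j * (prod (cluster_value i) (minus_part i j) * prod x {i..<j}))"
      using numerator_mult_x[OF minus, of j] j by (auto intro: numerator_mono)
    then show ?thesis using False j by (simp add: mult_ac)
  qed
  ultimately show ?case ..
qed

lemma root_variable_has_denominator:
  assumes "1 \<le> i" "i \<le> j" "j \<le> n"
  shows "has_denominator n x f (root_coeff i j) (X i j)"
proof (rule numerator_has_denominator)
  show "num {} (X i j * (\<Prod>k=1..n. x k ^ root_coeff i j k))"
    unfolding prod_root_coeff[OF assms]
    using numerator_root_variable_step[OF assms] numerator_parts[OF assms] by blast
qed

lemma root_variable_cluster_variable:
  assumes "1 \<le> i" "i \<le> j" "j \<le> n"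
  shows "cluster_variable n (initial_seed n \<xi> x f) (X i j)"
  unfolding cluster_variable_def
proof (intro exI conjI)
  show "reachable n (initial_seed n \<xi> x f) (seed x f i (Suc j))"
    unfolding seed_def using assms by (intro reachable_fold_mutate reachable.base) auto
  show "j \<in> {1..n}" using assms by simp
  show "X i j = fst (seed x f i (Suc j)) (Mut j)" using assms by (simp add: root_variable_seed)
qed

end

theorem proposition1p5:
  fixes n i j :: nat and \<xi> :: "nat \<Rightarrow> int"
    and x f :: "nat \<Rightarrow> 'a::field_char_0"
  defines "X \<equiv> root_variable n \<xi> x f"
    and "d \<equiv> dlt n \<xi>"
    and "b \<equiv> bullet n \<xi>"
  assumes "n \<ge> 2"
    and "height_function n \<xi>"
    and "algebraically_independent (vertices n) (initial_cluster x f)"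
    and "x 0 = 1" and "x (n + 1) = 1"
    and "1 \<le> i" and "i < j" and "j \<le> n"
  shows
    "(\<forall>k l. 1 \<le> k \<and> k \<le> l \<and> l \<le> n \<longrightarrow>
        cluster_variable n (initial_seed n \<xi> x f) (X k l) \<and>
        has_denominator n x f (root_coeff k l) (X k l))
   \<and> x i * X i i =
       f i * x (i + 1) ^ (1 - d i) + f (i + 1) ^ (1 - d i) * x (i - 1) * x (i + 1) ^ d i
   \<and> x j * X i j =
       f j ^ d (j - 1) * X i (j - 1) * x (j + 1) ^ (1 - d j)
       + f (j + 1) ^ (1 - d j) * x (j + 1) ^ d j *
         ((of_bool (b i = b j) + of_bool (i = b j))
            * f i ^ (of_bool (i = b j) * d i) * x (i - 1) ^ (1 - of_bool (i = b j))
          + (1 - of_bool (b i = b j) - of_bool (i = b j))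
            * f (b j) ^ d (b j - 1) * X i (b j - 1))"
proof -
  \<comment> \<open>Algebraic independence makes the initial variables nonzero, so the divisions in
    the mutations can be cleared.\<close>
  have "x k \<noteq> 0" if "1 \<le> k" "k \<le> n" for k
    using algebraically_independent_nonzero[OF assms(6), of "Mut k"] that
    by (simp add: vertices_def)
  then interpret height_quiver_cluster n \<xi> x f
    using assms by unfold_locales simp_all
  have "prod (cluster_value i) (plus_part i j) = f j ^ d (j - 1) * X i (j - 1)"
    using prod_plus_part_Suc[of i "j - 1"] assms by (simp add: X_def d_def mult.commute)
  then have "x j * X i j = f j ^ d (j - 1) * X i (j - 1) * x (j + 1) ^ (1 - d j)
      + f (j + 1) ^ (1 - d j) * x (j + 1) ^ d j * prod (cluster_value i) (minus_part i j)"
    using exchange_relation[of i j] assms by (simp add: X_def d_def)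
  moreover have "x i * X i i =
      f i * x (i + 1) ^ (1 - d i) + f (i + 1) ^ (1 - d i) * x (i - 1) * x (i + 1) ^ d i"
    using exchange_relation[of i i] prod_minus_part_self[of i] assms
    by (simp add: X_def d_def prod_plus_part_self mult_ac)
  \<comment> \<open>This identifies \<open>X k l\<close> as the cluster variable attached to its
    root: it is reached by mutation and has the denominator given by the root.\<close>
  moreover have "cluster_variable n (initial_seed n \<xi> x f) (X k l) \<and>
      has_denominator n x f (root_coeff k l) (X k l)" if "1 \<le> k" "k \<le> l" "l \<le> n" for k l
    unfolding X_def
    using root_variable_cluster_variable[OF that] root_variable_has_denominator[OF that] ..
  moreover have "prod (cluster_value i) (minus_part i j) =
      (of_bool (b i = b j) + of_bool (i = b j))
        * f i ^ (of_bool (i = b j) * d i) * x (i - 1) ^ (1 - of_bool (i = b j))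
      + (1 - of_bool (b i = b j) - of_bool (i = b j))
        * f (b j) ^ d (b j - 1) * X i (b j - 1)"
    unfolding X_def d_def b_def using assms by (intro prod_minus_part)
  ultimately show ?thesis by (simp only: simp_thms) blast
qed

end
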